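(* Let $n\ge 1$ be an integer and let $\mathbf{U}=(u_{j\,l})_{0\le j,l<n}\in\mathbb{C}^{n\times n}$ be an arbitrary unitary matrix, i.e. $\mathbf{U}\mathbf{U}^{\dagger}=\mathbf{I}$. For $0\le k,l<n$ let $$\mathbf{Q}_{\mathbf{U}}(k,l)=\sum_{0\le j<n}\left(\mathbf{e}_{j}\mathbf{e}_{(j+k \bmod n)}^{t}\right)u_{j\,l}.$$ Then $\{\mathbf{Q}_{\mathbf{U}}(k,l)\}_{0\le k,l<n}$ is a complete orthogonal basis of the vector space $\mathbb{C}^{n\times n}$.
   Context: $\{\mathbf{e}_j\}_{0\le j<n}$ is the canonical basis of $n$-dimensional column vectors, with indices starting at $0$. The space $\mathbb{C}^{n\times n}$ carries the inner product $\langle \mathbf{A},\mathbf{M}\rangle := \mathrm{Tr}(\mathbf{A}\mathbf{M}^{\dagger})$, where $\dagger$ is the conjugate transpose; orthogonality refers to this inner product. An orthogonal basis of a subspace of $\mathbb{C}^{n\times n}$ is called complete if it spans all of $\mathbb{C}^{n\times n}$. *)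

theory Defs
  imports "Jordan_Normal_Form.VS_Connect" "Jordan_Normal_Form.Schur_Decomposition"
begin

abbreviation mat_space :: "nat \<Rightarrow> (complex, complex mat) module" where
  "mat_space n \<equiv> module_mat TYPE(complex) n n"

definition mat_trace :: "complex mat \<Rightarrow> complex" where
  "mat_trace A = (\<Sum>i<dim_row A. A $$ (i, i))"

definition mat_inner :: "complex mat \<Rightarrow> complex mat \<Rightarrow> complex" where
  "mat_inner A M = mat_trace (A * mat_adjoint M)"

definition basis_col :: "nat \<Rightarrow> nat \<Rightarrow> complex mat" where
  "basis_col n j = mat_of_cols n [unit_vec n j]"

definition Q_mat :: "nat \<Rightarrow> complex mat \<Rightarrow> nat \<Rightarrow> nat \<Rightarrow> complex mat" where
  "Q_mat n U k l =
    (\<Oplus>\<^bsub>mat_space n\<^esub>j\<in>{0..<n}.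
      U $$ (j, l) \<cdot>\<^sub>m (basis_col n j * transpose_mat (basis_col n ((j + k) mod n))))"

(* Bases are indexed families: orthogonality and linear independence refer to
   distinct indices, so members with different indices must be distinct matrices. *)
definition orthogonal_basis_of :: "nat \<Rightarrow> complex mat set \<Rightarrow> 'i set \<Rightarrow> ('i \<Rightarrow> complex mat) \<Rightarrow> bool" where
  "orthogonal_basis_of n W I F \<longleftrightarrow>
    VectorSpace.subspace class_ring W (mat_space n) \<and>
    inj_on F I \<and>
    pairwise (\<lambda>i j. mat_inner (F i) (F j) = 0) I \<and>
    vectorspace.basis class_ring (mat_space n\<lparr>carrier := W\<rparr>) (F ` I)"

definition complete_orthogonal_basis :: "nat \<Rightarrow> 'i set \<Rightarrow> ('i \<Rightarrow> complex mat) \<Rightarrow> bool" where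
  "complete_orthogonal_basis n I F \<longleftrightarrow> orthogonal_basis_of n (carrier_mat n n) I F"

end

theory Submission
  imports Defs
begin

text \<open>
  The matrix \<open>Q(k,l)\<close> is column \<open>l\<close> of \<open>U\<close> written along the \<open>k\<close>-th cyclic diagonal: its entry at
  \<open>(x, (x + k) mod n)\<close> is \<open>u\<^bsub>x l\<^esub>\<close>, and all others vanish. The \<open>n\<close> cyclic diagonals partition the
  index square, so the claim splits into \<open>n\<close> copies of the same question in \<open>\<complex>\<^sup>n\<close>, namely whether
  the columns of \<open>U\<close> form an orthogonal basis there. The two halves of unitarity answer the two halves
  of that question. Since \<open>U\<^sup>\<dagger> U = I\<close>, the family is orthonormal (\<open>Q_mat_orthonormal\<close>), hence
  injective and linearly independent. Since \<open>U U\<^sup>\<dagger> = I\<close>, the coefficient formula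
  \<open>A = \<Sum>\<^bsub>k,l\<^esub> \<langle>A, Q(k,l)\<rangle> Q(k,l)\<close> holds entry by entry (\<open>Q_mat_expansion\<close>), hence the family spans.
  Only the second identity is a hypothesis; the first follows because a one-sided inverse of a square
  matrix is two-sided.

  The passage from these two facts to a basis of the matrix space works for any finite orthonormal
  family that admits such expansions (\<open>complete_orthogonal_basisI\<close>).
\<close>

section \<open>Entries of sums and products of matrices\<close>

lemma finsum_mat_closed:
  assumes "\<And>x. x \<in> S \<Longrightarrow> f x \<in> carrier_mat n n"
  shows "finsum (mat_space n) f S \<in> carrier_mat n n"
proof -
  interpret abelian_group "mat_space n" by (rule abelian_group_mat)
  show ?thesis using finsum_closed[of f S] assms by (auto simp: module_mat_simps Pi_iff)
qed

lemma finsum_mat_index: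
  assumes "finite S" and "\<And>x. x \<in> S \<Longrightarrow> f x \<in> carrier_mat n n" and "i < n" "j < n"
  shows "finsum (mat_space n) f S $$ (i, j) = (\<Sum>x\<in>S. f x $$ (i, j))"
proof -
  interpret abelian_group "mat_space n" by (rule abelian_group_mat)
  show ?thesis using assms(1,2)
  proof (induction S rule: finite_induct)
    case empty
    then show ?case using assms(3,4) by (simp add: finsum_empty module_mat_simps)
  next
    case (insert a S)
    have "finsum (mat_space n) f (insert a S) = f a + finsum (mat_space n) f S"
      using insert by (subst finsum_insert) (auto simp: module_mat_simps)
    moreover have "finsum (mat_space n) f S \<in> carrier_mat n n"
      using insert by (intro finsum_mat_closed) auto
    ultimately show ?case using insert assms(3,4) by auto
  qed
qed

lemma mat_adjoint_carrier:
  fixes A :: "complex mat"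
  assumes "A \<in> carrier_mat n m"
  shows "mat_adjoint A \<in> carrier_mat m n"
  using assms unfolding mat_adjoint_def by (auto simp: mat_of_rows_def)

lemma mat_adjoint_index:
  fixes A :: "complex mat"
  assumes "A \<in> carrier_mat n m" "i < m" "j < n"
  shows "mat_adjoint A $$ (i, j) = cnj (A $$ (j, i))"
  using assms unfolding mat_adjoint_def by (auto simp: mat_of_rows_def)

lemma mat_mult_index:
  fixes A B :: "complex mat"
  assumes "A \<in> carrier_mat n m" "B \<in> carrier_mat m p" "i < n" "j < p"
  shows "(A * B) $$ (i, j) = (\<Sum>k<m. A $$ (i, k) * B $$ (k, j))"
  using assms by (auto simp: scalar_prod_def atLeast0LessThan intro!: sum.cong)

text \<open>In entries, the trace inner product is the standard Hermitian one on vectors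
  of length \<open>n * n\<close>; this form is linear in its first argument term by term.\<close>

lemma mat_inner_sum:
  assumes "A \<in> carrier_mat n n" "B \<in> carrier_mat n n"
  shows "mat_inner A B = (\<Sum>i<n. \<Sum>j<n. A $$ (i, j) * cnj (B $$ (i, j)))"
  unfolding mat_inner_def mat_trace_def
  using assms mat_adjoint_carrier[OF assms(2)]
  by (auto simp: mat_mult_index[OF assms(1) mat_adjoint_carrier[OF assms(2)]]
      mat_adjoint_index[OF assms(2)] simp del: index_mult_mat(1) intro!: sum.cong)

lemma unitary_rows:
  assumes U: "U \<in> carrier_mat n n" and UU: "U * mat_adjoint U = 1\<^sub>m n" and "x < n" "y < n"
  shows "(\<Sum>l<n. U $$ (x, l) * cnj (U $$ (y, l))) = (if x = y then 1 else 0)"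
proof -
  have "(\<Sum>l<n. U $$ (x, l) * cnj (U $$ (y, l))) = (U * mat_adjoint U) $$ (x, y)"
    using assms(3,4) by (simp add: mat_mult_index[OF U mat_adjoint_carrier[OF U]]
        mat_adjoint_index[OF U] del: index_mult_mat(1))
  then show ?thesis using assms by simp
qed

text \<open>The relation for columns is the one for rows after \<open>U U\<^sup>\<dagger> = I\<close> has been turned into
  \<open>U\<^sup>\<dagger> U = I\<close>, which uses that the matrix is square.\<close>

lemma unitary_columns:
  assumes U: "U \<in> carrier_mat n n" and UU: "U * mat_adjoint U = 1\<^sub>m n" and "l < n" "m < n"
  shows "(\<Sum>x<n. U $$ (x, l) * cnj (U $$ (x, m))) = (if l = m then 1 else 0)"
proof -
  note U' = mat_adjoint_carrier[OF U]
  have "(\<Sum>x<n. U $$ (x, l) * cnj (U $$ (x, m))) = (mat_adjoint U * U) $$ (m, l)"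
    using assms(3,4) by (simp add: mat_mult_index[OF U' U] mat_adjoint_index[OF U] mult.commute
        del: index_mult_mat(1))
  also have "mat_adjoint U * U = 1\<^sub>m n"
    by (rule mat_mult_left_right_inverse[OF U U' UU])
  finally show ?thesis using assms by auto
qed

section \<open>Orthonormal families that span\<close>

text \<open>Pairing a linear combination with a member of an orthonormal family reads off that member's
  coefficient; this gives both injectivity (two indices with the same matrix would have inner
  product 1 and 0 at once) and linear independence. The expansion hypothesis is stated for entries
  so that it can be verified by finite sums of complex numbers.\<close>

lemma complete_orthogonal_basisI:
  assumes fin: "finite I"
    and F: "\<And>i. i \<in> I \<Longrightarrow> F i \<in> carrier_mat n n"
    and ortho: "\<And>i j. i \<in> I \<Longrightarrow> j \<in> I \<Longrightarrow> mat_inner (F i) (F j) = (if i = j then 1 else 0)"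
    and expand: "\<And>A. A \<in> carrier_mat n n \<Longrightarrow>
      \<exists>c. \<forall>x<n. \<forall>y<n. A $$ (x, y) = (\<Sum>i\<in>I. c i * F i $$ (x, y))"
  shows "complete_orthogonal_basis n I F"
proof -
  interpret V: matrix_vs n n "TYPE(complex)" .
  have inj: "inj_on F I"
    by (rule inj_onI, rule ccontr) (metis ortho zero_neq_one)
  have sub: "F ` I \<subseteq> carrier_mat n n" using F by auto
  have lin_carrier: "V.lincomb a (F ` I) \<in> carrier_mat n n" for a
    using F unfolding V.lincomb_def by (auto simp: module_mat_simps intro!: finsum_mat_closed)
  have lin_index: "V.lincomb a (F ` I) $$ (x, y) = (\<Sum>i\<in>I. a (F i) * F i $$ (x, y))"
    if "x < n" "y < n" for a x y
  proof -
    have "V.lincomb a (F ` I) $$ (x, y) = (\<Sum>v\<in>F ` I. (a v \<cdot>\<^sub>m v) $$ (x, y))"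
      unfolding V.lincomb_def module_mat_simps
      using that fin F by (intro finsum_mat_index) (auto simp: module_mat_simps)
    also have "\<dots> = (\<Sum>i\<in>I. (a (F i) \<cdot>\<^sub>m F i) $$ (x, y))"
      using inj by (simp add: sum.reindex)
    also have "\<dots> = (\<Sum>i\<in>I. a (F i) * F i $$ (x, y))"
      using that F by (intro sum.cong refl) (metis carrier_matD index_smult_mat(1))
    finally show ?thesis .
  qed
  have coeff: "mat_inner (V.lincomb a (F ` I)) (F j) = a (F j)" if j: "j \<in> I" for a j
  proof -
    have "mat_inner (V.lincomb a (F ` I)) (F j)
      = (\<Sum>x<n. \<Sum>y<n. \<Sum>i\<in>I. a (F i) * (F i $$ (x, y) * cnj (F j $$ (x, y))))"
      using F j by (simp add: mat_inner_sum[OF lin_carrier] lin_index sum_distrib_right mult.assoc)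
    also have "\<dots> = (\<Sum>x<n. \<Sum>i\<in>I. \<Sum>y<n. a (F i) * (F i $$ (x, y) * cnj (F j $$ (x, y))))"
      by (intro sum.cong refl sum.swap)
    also have "\<dots> = (\<Sum>i\<in>I. \<Sum>x<n. \<Sum>y<n. a (F i) * (F i $$ (x, y) * cnj (F j $$ (x, y))))"
      by (rule sum.swap)
    also have "\<dots> = (\<Sum>i\<in>I. a (F i) * mat_inner (F i) (F j))"
      using F j by (intro sum.cong refl) (simp add: mat_inner_sum[OF F F] sum_distrib_left)
    also have "\<dots> = (\<Sum>i\<in>I. if i = j then a (F j) else 0)"
      using j by (intro sum.cong refl) (auto simp: ortho)
    finally show ?thesis using fin j by simp
  qed
  have indpt: "V.lin_indpt (F ` I)"
  proof (rule V.finite_lin_indpt2)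
    fix a assume zero: "V.lincomb a (F ` I) = 0\<^sub>m n n"
    have "a (F j) = 0" if "j \<in> I" for j
      using coeff[OF that, of a] F[OF that] by (simp add: zero mat_inner_sum[OF zero_carrier_mat])
    then show "\<forall>v\<in>F ` I. a v = 0" by auto
  qed (use fin sub in auto)
  have "V.span (F ` I) = carrier_mat n n"
  proof
    show "V.span (F ` I) \<subseteq> carrier_mat n n"
      using sub by (rule V.span_is_subset2)
    show "carrier_mat n n \<subseteq> V.span (F ` I)"
    proof
      fix A :: "complex mat" assume A: "A \<in> carrier_mat n n"
      obtain c where c: "\<And>x y. x < n \<Longrightarrow> y < n \<Longrightarrow> A $$ (x, y) = (\<Sum>i\<in>I. c i * F i $$ (x, y))"
        using expand[OF A] by blast
      (* lincomb takes coefficients as a function of the vector, so c is carried along F. *)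
      define a where "a = c \<circ> inv_into I F"
      have "A = V.lincomb a (F ` I)"
        using A lin_carrier[of a] inj
        by (intro eq_matI) (auto simp: c lin_index a_def intro!: sum.cong)
      then show "A \<in> V.span (F ` I)"
        using fin sub by (auto simp: V.finite_span)
    qed
  qed
  then have basis: "V.basis (F ` I)"
    using indpt sub by (simp add: V.basis_def)
  have carrier: "mat_space n\<lparr>carrier := carrier_mat n n\<rparr> = mat_space n"
    by (simp add: module_mat_def)
  have "VectorSpace.subspace class_ring (carrier_mat n n) (mat_space n)"
    unfolding VectorSpace.subspace_def submodule_def
    using V.vectorspace_axioms V.module_axioms
    by (auto simp: module_mat_simps)
  moreover have "pairwise (\<lambda>i j. mat_inner (F i) (F j) = 0) I"
    by (auto simp: pairwise_def ortho)
  ultimately show ?thesis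
    unfolding complete_orthogonal_basis_def orthogonal_basis_of_def carrier
    using inj basis by blast
qed

section \<open>The matrices supported on cyclic diagonals\<close>

lemma basis_col_outer:
  assumes "j < n" "m < n"
  shows "basis_col n j * transpose_mat (basis_col n m) \<in> carrier_mat n n"
    and "\<And>x y. x < n \<Longrightarrow> y < n \<Longrightarrow> (basis_col n j * transpose_mat (basis_col n m)) $$ (x, y)
      = (if x = j \<and> y = m then 1 else 0)"
  using assms by (auto simp: basis_col_def mat_of_cols_def scalar_prod_def unit_vec_def)

lemma Q_mat_carrier: "Q_mat n U k l \<in> carrier_mat n n"
  unfolding Q_mat_def
  by (rule finsum_mat_closed) (auto intro!: smult_carrier_mat basis_col_outer(1))

lemma Q_mat_index:
  assumes "x < n" "y < n"
  shows "Q_mat n U k l $$ (x, y) = (if y = (x + k) mod n then U $$ (x, l) else 0)"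
proof -
  let ?E = "\<lambda>j. basis_col n j * transpose_mat (basis_col n ((j + k) mod n))"
  have E: "?E j \<in> carrier_mat n n" if "j < n" for j
    using that by (intro basis_col_outer(1)) auto
  have "Q_mat n U k l $$ (x, y) = (\<Sum>j\<in>{0..<n}. (U $$ (j, l) \<cdot>\<^sub>m ?E j) $$ (x, y))"
    unfolding Q_mat_def using assms E by (intro finsum_mat_index) (auto intro!: smult_carrier_mat)
  also have "\<dots> = (\<Sum>j\<in>{0..<n}. if j = x then (if y = (x + k) mod n then U $$ (x, l) else 0) else 0)"
  proof (intro sum.cong refl)
    fix j assume "j \<in> {0..<n}"
    then have j: "j < n" by simp
    have "(U $$ (j, l) \<cdot>\<^sub>m ?E j) $$ (x, y) = U $$ (j, l) * ?E j $$ (x, y)"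
      using E[OF j] assms by (metis carrier_matD index_smult_mat(1))
    also have "?E j $$ (x, y) = (if x = j \<and> y = (j + k) mod n then 1 else 0)"
      using j assms by (intro basis_col_outer(2)) auto
    finally show "(U $$ (j, l) \<cdot>\<^sub>m ?E j) $$ (x, y)
      = (if j = x then (if y = (x + k) mod n then U $$ (x, l) else 0) else 0)" by auto
  qed
  finally show ?thesis using assms by simp
qed

text \<open>Each position lies on exactly one cyclic diagonal.\<close>

lemma add_mod_eq_iff:
  fixes x y k n :: nat
  assumes "x < n" "y < n" "k < n"
  shows "y = (x + k) mod n \<longleftrightarrow> k = (y + n - x) mod n"
  using assms by (auto simp: mod_if)

lemma Q_mat_orthonormal:
  assumes U: "U \<in> carrier_mat n n" "U * mat_adjoint U = 1\<^sub>m n"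
    and "k < n" "l < n" "k' < n" "l' < n"
  shows "mat_inner (Q_mat n U k l) (Q_mat n U k' l') = (if k = k' \<and> l = l' then 1 else 0)"
proof -
  have "mat_inner (Q_mat n U k l) (Q_mat n U k' l')
    = (\<Sum>x<n. \<Sum>y<n. if y = (x + k) mod n
        then (if k = k' then U $$ (x, l) * cnj (U $$ (x, l')) else 0) else 0)"
    using assms unfolding mat_inner_sum[OF Q_mat_carrier Q_mat_carrier]
    by (intro sum.cong refl) (auto simp: Q_mat_index add_mod_eq_iff)
  also have "\<dots> = (\<Sum>x<n. if k = k' then U $$ (x, l) * cnj (U $$ (x, l')) else 0)"
    by (intro sum.cong refl) (auto simp: sum.delta)
  also have "\<dots> = (if k = k' then \<Sum>x<n. U $$ (x, l) * cnj (U $$ (x, l')) else 0)"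
    by simp
  finally show ?thesis using unitary_columns[OF U assms(4,6)] by auto
qed

text \<open>At \<open>(x, y)\<close> only the diagonal through that position contributes, and there the claim is the
  expansion of a vector in the orthonormal columns of \<open>U\<close>. The coefficients are the inner products
  of \<open>A\<close> with the \<open>Q(k,l)\<close>.\<close>

lemma Q_mat_expansion:
  assumes U: "U \<in> carrier_mat n n" "U * mat_adjoint U = 1\<^sub>m n"
    and "x < n" "y < n"
  shows "A $$ (x, y) = (\<Sum>k<n. \<Sum>l<n.
    (\<Sum>i<n. A $$ (i, (i + k) mod n) * cnj (U $$ (i, l))) * Q_mat n U k l $$ (x, y))"
proof -
  define d where "d = (y + n - x) mod n"
  have d: "d < n" "y = (x + d) mod n"
    using assms add_mod_eq_iff[of x n y d] by (auto simp: d_def)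
  let ?c = "\<lambda>k l. \<Sum>i<n. A $$ (i, (i + k) mod n) * cnj (U $$ (i, l))"
  have "(\<Sum>k<n. \<Sum>l<n. ?c k l * Q_mat n U k l $$ (x, y))
    = (\<Sum>k<n. if k = d then (\<Sum>l<n. ?c d l * U $$ (x, l)) else 0)"
    using assms by (intro sum.cong refl) (auto simp: Q_mat_index add_mod_eq_iff d_def)
  also have "\<dots> = (\<Sum>l<n. \<Sum>i<n. A $$ (i, (i + d) mod n) * (U $$ (x, l) * cnj (U $$ (i, l))))"
    using d(1) by (simp add: sum_distrib_left mult_ac)
  also have "\<dots> = (\<Sum>i<n. A $$ (i, (i + d) mod n) * (\<Sum>l<n. U $$ (x, l) * cnj (U $$ (i, l))))"
    by (subst sum.swap) (simp add: sum_distrib_left)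
  also have "\<dots> = (\<Sum>i<n. if i = x then A $$ (x, (x + d) mod n) else 0)"
    using assms by (intro sum.cong refl) (auto simp: unitary_rows)
  also have "\<dots> = A $$ (x, y)"
    using assms(3) d(2) by simp
  finally show ?thesis by simp
qed

theorem mainTheorem3:
  fixes n :: nat and U :: "complex mat"
  assumes "n \<ge> 1"
    and "U \<in> carrier_mat n n"
    and "U * mat_adjoint U = 1\<^sub>m n"
  shows "complete_orthogonal_basis n ({0..<n} \<times> {0..<n}) (\<lambda>(k, l). Q_mat n U k l)"
proof (rule complete_orthogonal_basisI)
  fix A :: "complex mat"
  let ?c = "\<lambda>(k, l). \<Sum>i<n. A $$ (i, (i + k) mod n) * cnj (U $$ (i, l))"
  show "\<exists>c. \<forall>x<n. \<forall>y<n. A $$ (x, y)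
    = (\<Sum>p\<in>{0..<n} \<times> {0..<n}. c p * (case p of (k, l) \<Rightarrow> Q_mat n U k l) $$ (x, y))"
  proof (intro exI[of _ ?c] allI impI)
    fix x y assume "x < n" "y < n"
    from Q_mat_expansion[OF assms(2,3) this, of A]
    show "A $$ (x, y)
      = (\<Sum>p\<in>{0..<n} \<times> {0..<n}. ?c p * (case p of (k, l) \<Rightarrow> Q_mat n U k l) $$ (x, y))"
      by (simp add: sum.cartesian_product atLeast0LessThan case_prod_unfold)
  qed
qed (auto simp: Q_mat_carrier Q_mat_orthonormal[OF assms(2,3)] split: if_splits)

end
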